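(* Let $F:S_n(\mathbb{R})\to\mathbb{R}$ be an admissible operator that is uniformly elliptic ($\theta>0$), let $H$ be an admissible gradient constraint with support function $\ell$, and let $f:\mathbb{R}^n\to\mathbb{R}$ be convex and superlinear. Assume $$f(Ox)=f(x),\qquad H(O^tp)=H(p),\qquad F(OMO^t)=F(M)$$ for each $x,p\in\mathbb{R}^n$, $M\in S_n(\mathbb{R})$ and each orthogonal $n\times n$ matrix $O$. Then any two convex, rotationally symmetric viscosity solutions $u$ of $$\max\{\lambda^*+F(D^2u)-f(x),\,H(Du)\}=0,\quad x\in\mathbb{R}^n,$$ that satisfy $\lim_{|x|\to\infty}u(x)/\ell(x)=1$ differ by an additive constant.
   Context: $S_n(\mathbb{R})$ is the space of real symmetric $n\times n$ matrices. $F:S_n(\mathbb{R})\to\mathbb{R}$ is an admissible operator with constants $\theta,\Theta\ge0$ if for all $M,N\in S_n(\mathbb{R})$ and $t\ge0$: $-\Theta\,\mathrm{tr}N\le F(M+N)-F(M)\le-\theta\,\mathrm{tr}N$ whenever $N\ge0$; $F(tM)=tF(M)$; $F(M)+F(N)\le F(M+N)$. For $H\in C(\mathbb{R}^n)$ with $\{H\le0\}$ compact and nonempty, the support function is $\ell(v)=\max\{p\cdot v:H(p)\le0\}$ and $H_0(p)=\max_{|v|=1}\{p\cdot v-\ell(v)\}$. $H$ is an admissible gradient constraint if $H(0)<0$, the set $\{p:H(p)\le0\}$ is compact and strictly convex, and $H(p)$ and $H_0(p)$ have the same sign (negative, zero, positive) for every $p$. $f$ is superlinear if $\lim_{|x|\to\infty}f(x)/|x|=\infty$.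 $\lambda^*$ is the unique real number $\lambda$ for which $\max\{\lambda+F(D^2u)-f(x),H(Du)\}=0$ in $\mathbb{R}^n$ has a viscosity solution $u\in C(\mathbb{R}^n)$ with $\lim_{|x|\to\infty}u(x)/\ell(x)=1$ (existence and uniqueness of $\lambda^*$ is known under these assumptions). Rotationally symmetric means that $u(x)$ depends only on $|x|$. *)

theory Defs
  imports "HOL-Analysis.Analysis"
begin

definition sym_matrix :: "real^'n^'n \<Rightarrow> bool" where
  "sym_matrix M \<longleftrightarrow> transpose M = M"

definition pos_semidef :: "real^'n^'n \<Rightarrow> bool" where
  "pos_semidef N \<longleftrightarrow> sym_matrix N \<and> (\<forall>x. 0 \<le> x \<bullet> (N *v x))"

text \<open>
  The space of real symmetric matrices is not a type of its own: an operator on it is a function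
  on all square matrices of which only the values at symmetric matrices matter.
\<close>

definition admissible_operator :: "real \<Rightarrow> real \<Rightarrow> (real^'n^'n \<Rightarrow> real) \<Rightarrow> bool" where
  "admissible_operator \<theta> \<Theta> F \<longleftrightarrow>
     0 \<le> \<theta> \<and> 0 \<le> \<Theta> \<and>
     (\<forall>M N. sym_matrix M \<longrightarrow> pos_semidef N \<longrightarrow>
        - \<Theta> * trace N \<le> F (M + N) - F M \<and> F (M + N) - F M \<le> - \<theta> * trace N) \<and>
     (\<forall>M t. sym_matrix M \<longrightarrow> 0 \<le> t \<longrightarrow> F (t *\<^sub>R M) = t * F M) \<and>
     (\<forall>M N. sym_matrix M \<longrightarrow> sym_matrix N \<longrightarrow> F M + F N \<le> F (M + N))"

text \<open>
  When the sublevel set of \<open>H\<close> is compact and nonempty, both suprema below are attained: they are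
  suprema of continuous functions over nonempty compact sets.
\<close>

definition support_fun :: "(real^'n \<Rightarrow> real) \<Rightarrow> real^'n \<Rightarrow> real" where
  "support_fun H v = (SUP p\<in>{p. H p \<le> 0}. p \<bullet> v)"

definition dual_constraint :: "(real^'n \<Rightarrow> real) \<Rightarrow> real^'n \<Rightarrow> real" where
  "dual_constraint H p = (SUP v\<in>sphere 0 1. p \<bullet> v - support_fun H v)"

definition strictly_convex :: "(real^'n) set \<Rightarrow> bool" where
  "strictly_convex S \<longleftrightarrow> (\<forall>x\<in>S. \<forall>y\<in>S. x \<noteq> y \<longrightarrow> open_segment x y \<subseteq> interior S)"

definition admissible_gradient_constraint :: "(real^'n \<Rightarrow> real) \<Rightarrow> bool" where
  "admissible_gradient_constraint H \<longleftrightarrow>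
     continuous_on UNIV H \<and> H 0 < 0 \<and>
     compact {p. H p \<le> 0} \<and> strictly_convex {p. H p \<le> 0} \<and>
     (\<forall>p. sgn (H p) = sgn (dual_constraint H p))"

definition superlinear :: "(real^'n \<Rightarrow> real) \<Rightarrow> bool" where
  "superlinear f \<longleftrightarrow> filterlim (\<lambda>x. f x / norm x) at_top at_infinity"

text \<open>
  \<open>\<phi>\<close> is of class \<open>C\<^sup>2\<close> with gradient \<open>g\<close> and Hessian \<open>h\<close>; the matrices \<open>h x\<close> are then symmetric
  by the symmetry of second derivatives.
\<close>

definition C2_with_derivs ::
    "(real^'n \<Rightarrow> real) \<Rightarrow> (real^'n \<Rightarrow> real^'n) \<Rightarrow> (real^'n \<Rightarrow> real^'n^'n) \<Rightarrow> bool" where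
  "C2_with_derivs \<phi> g h \<longleftrightarrow>
     (\<forall>x. GDERIV \<phi> x :> g x) \<and>
     (\<forall>x. (g has_derivative (\<lambda>v. h x *v v)) (at x)) \<and>
     continuous_on UNIV h"

definition local_max_at :: "(real^'n \<Rightarrow> real) \<Rightarrow> real^'n \<Rightarrow> bool" where
  "local_max_at w x0 \<longleftrightarrow> eventually (\<lambda>x. w x \<le> w x0) (nhds x0)"

definition local_min_at :: "(real^'n \<Rightarrow> real) \<Rightarrow> real^'n \<Rightarrow> bool" where
  "local_min_at w x0 \<longleftrightarrow> eventually (\<lambda>x. w x0 \<le> w x) (nhds x0)"

text \<open>
  Viscosity solutions of \<open>max {\<mu> + F (D\<^sup>2 u) - f x, H (D u)} = 0\<close> on the whole space. The sign
  convention for sub- and supersolutions is the one for an operator that is nonincreasing in the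
  Hessian.
\<close>

definition viscosity_subsolution ::
    "(real^'n^'n \<Rightarrow> real) \<Rightarrow> (real^'n \<Rightarrow> real) \<Rightarrow> (real^'n \<Rightarrow> real) \<Rightarrow> real \<Rightarrow> (real^'n \<Rightarrow> real) \<Rightarrow> bool"
  where
  "viscosity_subsolution F H f \<mu> u \<longleftrightarrow>
     (\<forall>\<phi> g h x0. C2_with_derivs \<phi> g h \<longrightarrow> local_max_at (\<lambda>x. u x - \<phi> x) x0 \<longrightarrow>
        max (\<mu> + F (h x0) - f x0) (H (g x0)) \<le> 0)"

definition viscosity_supersolution ::
    "(real^'n^'n \<Rightarrow> real) \<Rightarrow> (real^'n \<Rightarrow> real) \<Rightarrow> (real^'n \<Rightarrow> real) \<Rightarrow> real \<Rightarrow> (real^'n \<Rightarrow> real) \<Rightarrow> bool"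
  where
  "viscosity_supersolution F H f \<mu> u \<longleftrightarrow>
     (\<forall>\<phi> g h x0. C2_with_derivs \<phi> g h \<longrightarrow> local_min_at (\<lambda>x. u x - \<phi> x) x0 \<longrightarrow>
        0 \<le> max (\<mu> + F (h x0) - f x0) (H (g x0)))"

definition viscosity_solution ::
    "(real^'n^'n \<Rightarrow> real) \<Rightarrow> (real^'n \<Rightarrow> real) \<Rightarrow> (real^'n \<Rightarrow> real) \<Rightarrow> real \<Rightarrow> (real^'n \<Rightarrow> real) \<Rightarrow> bool"
  where
  "viscosity_solution F H f \<mu> u \<longleftrightarrow>
     continuous_on UNIV u \<and>
     viscosity_subsolution F H f \<mu> u \<and> viscosity_supersolution F H f \<mu> u"

definition asymptotic_to_support :: "(real^'n \<Rightarrow> real) \<Rightarrow> (real^'n \<Rightarrow> real) \<Rightarrow> bool" where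
  "asymptotic_to_support H u \<longleftrightarrow> ((\<lambda>x. u x / support_fun H x) \<longlongrightarrow> 1) at_infinity"

text \<open>
  The eigenvalue \<open>\<lambda>\<^sup>*\<close>: for a uniformly elliptic admissible \<open>F\<close>, an admissible \<open>H\<close> and a convex
  superlinear \<open>f\<close> there is exactly one such number, so that the description is proper.
\<close>

definition eigenvalue ::
    "(real^'n^'n \<Rightarrow> real) \<Rightarrow> (real^'n \<Rightarrow> real) \<Rightarrow> (real^'n \<Rightarrow> real) \<Rightarrow> real" where
  "eigenvalue F H f =
     (THE \<mu>. \<exists>u. viscosity_solution F H f \<mu> u \<and> asymptotic_to_support H u)"

definition rotationally_symmetric :: "(real^'n \<Rightarrow> real) \<Rightarrow> bool" where
  "rotationally_symmetric u \<longleftrightarrow> (\<forall>x y. norm x = norm y \<longrightarrow> u x = u y)"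

end

theory Submission
  imports Defs
begin

text \<open>
  On a ray, a rotationally symmetric solution has a convex even profile \<open>\<phi>\<close>. Touching from below at
  a kink with arbitrarily large second derivative contradicts uniform ellipticity, so \<open>\<psi> = \<phi>'\<close> is
  continuous on \<open>[0, \<infinity>)\<close> with \<open>\<psi> 0 = 0\<close>. Where the gradient constraint is inactive, the strictly
  monotone equation \<open>\<mu> + F (\<psi>', \<psi> / s) = f\<close> can be solved for \<open>\<psi>'\<close> as a continuous function of \<open>s\<close>,
  hence holds classically, and at points where \<open>\<psi>\<^sub>1 \<ge> \<psi>\<^sub>2\<close> it gives \<open>\<psi>\<^sub>1' \<le> \<psi>\<^sub>2'\<close>. If
  \<open>\<psi>\<^sub>1 > \<psi>\<^sub>2\<close> at some \<open>s\<close>, consider the last \<open>a < s\<close> with \<open>\<psi>\<^sub>1 a \<le> \<psi>\<^sub>2 a\<close>. Then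
  \<open>\<psi>\<^sub>1 a \<le> \<psi>\<^sub>2 a \<le> \<psi>\<^sub>2 s < \<psi>\<^sub>1 s\<close>, so the constraint is inactive for both profiles just to the right
  of \<open>a\<close>, and \<open>\<psi>\<^sub>1 - \<psi>\<^sub>2\<close> cannot become positive there.
\<close>

subsection \<open>Radial Hessians and test functions\<close>

definition outer :: "real^'n \<Rightarrow> real^'n^'n" where
  "outer x = (\<chi> i j. x $ i * x $ j)"

lemma outer_mult_vec: "outer x *v v = (x \<bullet> v) *\<^sub>R x"
  by (simp add: outer_def vec_eq_iff matrix_vector_mult_def inner_vec_def sum_distrib_left
      sum_distrib_right mult_ac)

lemma outer_scaleR: "outer (c *\<^sub>R x) = c\<^sup>2 *\<^sub>R outer x"
  by (simp add: outer_def vec_eq_iff power2_eq_square)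

lemma trace_outer: "trace (outer x) = x \<bullet> x"
  by (simp add: outer_def trace_def inner_vec_def)

lemma continuous_on_outer: "continuous_on UNIV outer"
  unfolding outer_def by (intro continuous_intros)

text \<open>The Hessian of a radial function at \<open>s e\<close> with \<open>norm e = 1\<close>: eigenvalue \<open>a\<close> in the radial
  direction \<open>e\<close> and \<open>b\<close> in the tangential ones.\<close>
definition radial_hessian :: "real^'n \<Rightarrow> real \<Rightarrow> real \<Rightarrow> real^'n^'n" where
  "radial_hessian e a b = b *\<^sub>R mat 1 + (a - b) *\<^sub>R outer e"

lemma sym_radial_hessian: "sym_matrix (radial_hessian e a b)"
  by (simp add: sym_matrix_def radial_hessian_def transpose_def vec_eq_iff mat_def outer_def
      mult.commute)

lemma radial_hessian_mult_vec:
  "radial_hessian e a b *v v = b *\<^sub>R v + ((a - b) * (e \<bullet> v)) *\<^sub>R e"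
  by (simp add: radial_hessian_def matrix_vector_mult_add_rdistrib outer_mult_vec
      flip: scaleR_matrix_vector_assoc)

lemma trace_radial_hessian:
  fixes e :: "real^'n"
  assumes "norm e = 1"
  shows "trace (radial_hessian e a b) = a + (real CARD('n) - 1) * b"
proof -
  have scale: "trace (c *\<^sub>R M) = c * trace M" for c and M :: "real^'n^'n"
    by (simp add: trace_def sum_distrib_left)
  have "e \<bullet> e = 1"
    using assms by (simp add: norm_eq_1)
  then show ?thesis
    unfolding radial_hessian_def trace_add scale trace_I trace_outer by (simp add: algebra_simps)
qed

text \<open>The quadratic form is \<open>a\<close> times the squared component along
  \<open>e\<close> plus \<open>b\<close> times the squared length of the remainder, which is
  nonnegative by Cauchy-Schwarz.\<close>

lemma pos_semidef_radial_hessian: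
  assumes "norm e = 1" "0 \<le> a" "0 \<le> b"
  shows "pos_semidef (radial_hessian e a b)"
  unfolding pos_semidef_def
proof (intro conjI sym_radial_hessian allI)
  fix x
  have "(e \<bullet> x)\<^sup>2 \<le> x \<bullet> x"
    using Cauchy_Schwarz_ineq[of e x] assms by (simp add: norm_eq_1)
  then have "0 \<le> b * (x \<bullet> x - (e \<bullet> x)\<^sup>2) + a * (e \<bullet> x)\<^sup>2"
    using assms by simp
  also have "\<dots> = x \<bullet> (radial_hessian e a b *v x)"
    by (simp add: radial_hessian_mult_vec inner_add_right inner_commute power2_eq_square
        algebra_simps)
  finally show "0 \<le> x \<bullet> (radial_hessian e a b *v x)" .
qed

text \<open>The family of test functions. On the sphere \<open>x \<bullet> x = m\<close> the
  gradient depends on \<open>c1\<close> alone, and \<open>c2\<close> then adjusts only the radial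
  second derivative, to \<open>2 * c1 + 8 * c2 * m\<close>.\<close>

lemma C2_quartic:
  "C2_with_derivs (\<lambda>x::real^'n. c1 * (x \<bullet> x) + c2 * (x \<bullet> x - m)\<^sup>2)
     (\<lambda>x. (2 * c1 + 4 * c2 * (x \<bullet> x - m)) *\<^sub>R x)
     (\<lambda>x. (2 * c1 + 4 * c2 * (x \<bullet> x - m)) *\<^sub>R mat 1 + (8 * c2) *\<^sub>R outer x)"
  unfolding C2_with_derivs_def gderiv_def
proof (intro conjI allI)
  fix x :: "real^'n"
  show "((\<lambda>x. c1 * (x \<bullet> x) + c2 * (x \<bullet> x - m)\<^sup>2) has_derivative
      (\<lambda>v. v \<bullet> (2 * c1 + 4 * c2 * (x \<bullet> x - m)) *\<^sub>R x)) (at x)"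
    by (rule derivative_eq_intros refl | simp add: fun_eq_iff inner_commute algebra_simps)+
  show "((\<lambda>x. (2 * c1 + 4 * c2 * (x \<bullet> x - m)) *\<^sub>R x) has_derivative
      (\<lambda>v. ((2 * c1 + 4 * c2 * (x \<bullet> x - m)) *\<^sub>R mat 1 + (8 * c2) *\<^sub>R outer x) *v v)) (at x)"
    by (rule derivative_eq_intros refl
        | simp add: fun_eq_iff inner_commute matrix_vector_mult_add_rdistrib outer_mult_vec
            algebra_simps flip: scaleR_matrix_vector_assoc)+
  show "continuous_on UNIV
      (\<lambda>x::real^'n. (2 * c1 + 4 * c2 * (x \<bullet> x - m)) *\<^sub>R mat 1 + (8 * c2) *\<^sub>R outer x)"
    by (intro continuous_intros continuous_on_outer)
qed

text \<open>By the sign condition it suffices to bound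
  \<open>dual_constraint H (p *\<^sub>R e)\<close> by a negative number. A ball of radius
  \<open>\<rho>\<close> inside the set where \<open>H\<close> is negative forces
  \<open>support_fun H v\<close> to be at least \<open>\<rho>\<close> for unit \<open>v\<close>,
  while scaling down from \<open>q *\<^sub>R e\<close> bounds the inner product by
  \<open>\<tau> * support_fun H v\<close> with \<open>\<tau> < 1\<close>.\<close>

lemma gradient_constraint_ray:
  fixes H :: "real^'n \<Rightarrow> real"
  assumes "admissible_gradient_constraint H" "H (q *\<^sub>R e) \<le> 0" "0 \<le> p" "p < q"
  shows "H (p *\<^sub>R e) < 0"
proof -
  let ?S = "{p. H p \<le> 0}" and ?l = "support_fun H"
  have H: "continuous_on UNIV H" "H 0 < 0" "compact ?S"
    "sgn (H (p *\<^sub>R e)) = sgn (dual_constraint H (p *\<^sub>R e))"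
    using assms unfolding admissible_gradient_constraint_def by auto
  have "open {p. H p < 0}"
    using H(1) by (intro open_Collect_less) auto
  then obtain \<rho> where \<rho>: "0 < \<rho>" "cball 0 \<rho> \<subseteq> {p. H p < 0}"
    using H(2) open_contains_cball by blast
  have le: "y \<bullet> v \<le> ?l v" if "H y \<le> 0" for y v
    unfolding support_fun_def
  proof (rule cSUP_upper)
    have "compact ((\<lambda>y. y \<bullet> v) ` ?S)"
      by (intro compact_continuous_image continuous_intros H(3))
    then show "bdd_above ((\<lambda>y. y \<bullet> v) ` ?S)"
      by (intro bounded_imp_bdd_above compact_imp_bounded)
  qed (use that in simp)
  define \<tau> where "\<tau> = p / q"
  have \<tau>: "0 \<le> \<tau>" "\<tau> < 1" "\<tau> * q = p"
    using assms(3,4) by (auto simp: \<tau>_def)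
  have "dual_constraint H (p *\<^sub>R e) \<le> - (1 - \<tau>) * \<rho>"
    unfolding dual_constraint_def
  proof (rule cSUP_least)
    show "sphere 0 1 \<noteq> ({} :: (real^'n) set)"
      using vector_choose_size[of 1] by auto
    fix v :: "real^'n" assume "v \<in> sphere 0 1"
    then have v: "norm v = 1" by simp
    have "\<rho> *\<^sub>R v \<in> cball 0 \<rho>"
      using \<rho>(1) v by simp
    then have "H (\<rho> *\<^sub>R v) < 0"
      using \<rho>(2) by blast
    then have "(\<rho> *\<^sub>R v) \<bullet> v \<le> ?l v"
      by (intro le) simp
    then have "\<rho> \<le> ?l v"
      using v by (simp add: norm_eq_1)
    then have "(1 - \<tau>) * \<rho> \<le> (1 - \<tau>) * ?l v"
      using \<tau> by (intro mult_left_mono) auto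
    moreover have "\<tau> * ((q *\<^sub>R e) \<bullet> v) \<le> \<tau> * ?l v"
      using \<tau> by (intro mult_left_mono le assms(2))
    then have "(p *\<^sub>R e) \<bullet> v \<le> \<tau> * ?l v"
      by (simp flip: \<tau>(3) mult.assoc)
    ultimately show "(p *\<^sub>R e) \<bullet> v - ?l v \<le> - (1 - \<tau>) * \<rho>"
      by (simp add: algebra_simps)
  qed
  also have "\<dots> < 0"
    using \<tau> \<rho> by (simp add: mult_neg_pos)
  finally show ?thesis
    using H(4) by (simp add: sgn_if split: if_splits)
qed

subsection \<open>Profiles along a ray\<close>

text \<open>A profile touched by a parabola at \<open>t > 0\<close> is touched by an even quartic with almost the
  same second derivative; unlike the parabola, the quartic is the profile of a \<open>C\<^sup>2\<close> function on
  the whole space.\<close>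
lemma quartic_touching_below:
  fixes \<phi> :: "real \<Rightarrow> real"
  assumes t: "t \<noteq> 0" and "X' < X"
    and "\<forall>\<^sub>F s in nhds t. \<phi> t + p * (s - t) + X / 2 * (s - t)\<^sup>2 \<le> \<phi> s"
  defines "c1 \<equiv> p / (2 * t)" and "c2 \<equiv> (X' - p / t) / (8 * t\<^sup>2)"
  shows "\<forall>\<^sub>F s in nhds t. \<phi> t - c1 * t\<^sup>2 \<le> \<phi> s - (c1 * s\<^sup>2 + c2 * (s\<^sup>2 - t\<^sup>2)\<^sup>2)"
proof -
  \<comment> \<open>Up to a constant, parabola minus quartic is
    \<open>(s - t)\<^sup>2 * ?g s\<close>: \<open>c1\<close> matches the slope at \<open>t\<close>,
    and \<open>c2\<close> makes the second derivative of the quartic at \<open>t\<close> equal to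
    \<open>X'\<close>.\<close>
  let ?g = "\<lambda>s. X / 2 - c1 - c2 * (s + t)\<^sup>2"
  have "?g t = (X - X') / 2"
    using t by (simp add: c1_def c2_def field_simps power2_eq_square)
  then have "0 < ?g t"
    using assms(2) by simp
  moreover have "(?g \<longlongrightarrow> ?g t) (nhds t)"
    by (intro tendsto_intros filterlim_ident)
  ultimately have "\<forall>\<^sub>F s in nhds t. 0 < ?g s"
    by (rule order_tendstoD(1)[rotated])
  with assms(3) show ?thesis
  proof eventually_elim
    case (elim s)
    have p: "p = 2 * c1 * t"
      using t by (simp add: c1_def)
    have "\<phi> t + p * (s - t) + X / 2 * (s - t)\<^sup>2 - (c1 * s\<^sup>2 + c2 * (s\<^sup>2 - t\<^sup>2)\<^sup>2)
        = \<phi> t - c1 * t\<^sup>2 + (s - t)\<^sup>2 * ?g s"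
      unfolding p by (simp add: power2_eq_square field_simps)
    moreover have "0 \<le> (s - t)\<^sup>2 * ?g s"
      using elim by simp
    ultimately show ?case
      using elim by linarith
  qed
qed

text \<open>Reflection: the previous lemma for \<open>- \<phi>\<close>, with \<open>p\<close>,
  \<open>X\<close> and \<open>X'\<close> negated.\<close>

lemma quartic_touching_above:
  fixes \<phi> :: "real \<Rightarrow> real"
  assumes t: "t \<noteq> 0" and "X < X'"
    and "\<forall>\<^sub>F s in nhds t. \<phi> s \<le> \<phi> t + p * (s - t) + X / 2 * (s - t)\<^sup>2"
  defines "c1 \<equiv> p / (2 * t)" and "c2 \<equiv> (X' - p / t) / (8 * t\<^sup>2)"
  shows "\<forall>\<^sub>F s in nhds t. \<phi> s - (c1 * s\<^sup>2 + c2 * (s\<^sup>2 - t\<^sup>2)\<^sup>2) \<le> \<phi> t - c1 * t\<^sup>2"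
proof -
  have "\<forall>\<^sub>F s in nhds t. (- \<phi> t) + (- p) * (s - t) + (- X) / 2 * (s - t)\<^sup>2 \<le> - \<phi> s"
    using assms(3) by (rule eventually_mono) simp
  from quartic_touching_below[OF t _ this, of "- X'"] assms(2)
  have "\<forall>\<^sub>F s in nhds t. - \<phi> t - (- p) / (2 * t) * t\<^sup>2 \<le>
      - \<phi> s - ((- p) / (2 * t) * s\<^sup>2 + (- X' - (- p) / t) / (8 * t\<^sup>2) * (s\<^sup>2 - t\<^sup>2)\<^sup>2)"
    by simp
  moreover have "(- p) / (2 * t) = - c1" "(- X' - (- p) / t) / (8 * t\<^sup>2) = - c2"
    using t by (simp_all add: c1_def c2_def field_simps)
  ultimately have "\<forall>\<^sub>F s in nhds t. - \<phi> t - - c1 * t\<^sup>2 \<le>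
      - \<phi> s - (- c1 * s\<^sup>2 + - c2 * (s\<^sup>2 - t\<^sup>2)\<^sup>2)"
    by (simp only:)
  then show ?thesis
    by (rule eventually_mono) simp
qed

text \<open>As in Darboux's theorem, the derivative signs keep the minimum over
  \<open>{a..b}\<close> away from both ends. This supplies touching points where a slope crosses a
  prescribed line.\<close>

lemma interior_min_of_derivative_signs:
  fixes g :: "real \<Rightarrow> real"
  assumes "a < b" and der: "\<And>t. a \<le> t \<Longrightarrow> t \<le> b \<Longrightarrow> (g has_real_derivative g' t) (at t)"
    and "g' a < 0" "0 < g' b"
  obtains t where "a < t" "t < b" "g' t = 0" "\<forall>\<^sub>F y in nhds t. g t \<le> g y"
proof -
  have "continuous_on {a..b} g"
    using der by (auto intro!: continuous_at_imp_continuous_on DERIV_isCont)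
  then obtain t where t: "t \<in> {a..b}" and min: "\<And>y. y \<in> {a..b} \<Longrightarrow> g t \<le> g y"
    using continuous_attains_inf[of "{a..b}" g] assms(1) by auto
  obtain d where "d > 0" "\<And>h. 0 < h \<Longrightarrow> h < d \<Longrightarrow> g (a + h) < g a"
    using DERIV_neg_dec_right[OF der[of a] assms(3)] assms(1) by auto
  then have "g (a + min (d / 2) (b - a)) < g a"
    using assms(1) by (simp add: min_def)
  moreover have "a + min (d / 2) (b - a) \<in> {a..b}"
    using assms(1) \<open>d > 0\<close> by auto
  ultimately have "t \<noteq> a"
    using min by fastforce
  obtain d where "d > 0" "\<And>h. 0 < h \<Longrightarrow> h < d \<Longrightarrow> g (b - h) < g b"
    using DERIV_pos_inc_left[OF der[of b] assms(4)] assms(1) by auto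
  then have "g (b - min (d / 2) (b - a)) < g b"
    using assms(1) by (simp add: min_def)
  moreover have "b - min (d / 2) (b - a) \<in> {a..b}"
    using assms(1) \<open>d > 0\<close> by auto
  ultimately have "t \<noteq> b"
    using min by fastforce
  have ab: "a < t" "t < b"
    using t \<open>t \<noteq> a\<close> \<open>t \<noteq> b\<close> by auto
  have "\<forall>y. \<bar>t - y\<bar> < min (t - a) (b - t) \<longrightarrow> g t \<le> g y"
    by (auto intro!: min)
  then have "g' t = 0"
    using DERIV_local_min[OF der[of t], of "min (t - a) (b - t)"] ab by simp
  moreover have "\<forall>\<^sub>F y in nhds t. y \<in> {a<..<b}"
    using ab by (intro eventually_nhds_in_open) auto
  then have "\<forall>\<^sub>F y in nhds t. g t \<le> g y"
    by (rule eventually_mono) (use min in auto)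
  ultimately show thesis
    using that ab by blast
qed

text \<open>After cancelling one factor \<open>\<bar>y - s\<bar>\<close>, the left side tends to 0
  and the right side is \<open>d\<close>. A kink thus leaves room for parabolas of any
  curvature.\<close>

lemma parabola_below_cusp:
  fixes s :: real
  assumes "0 < d"
  shows "\<forall>\<^sub>F y in nhds s. X * (y - s)\<^sup>2 \<le> d * \<bar>y - s\<bar>"
proof -
  have "((\<lambda>y. X * \<bar>y - s\<bar>) \<longlongrightarrow> X * \<bar>s - s\<bar>) (nhds s)"
    by (intro tendsto_intros filterlim_ident)
  then have "\<forall>\<^sub>F y in nhds s. X * \<bar>y - s\<bar> < d"
    using assms by (intro order_tendstoD(2)) auto
  then show ?thesis
  proof eventually_elim
    case (elim y)
    then have "X * \<bar>y - s\<bar> * \<bar>y - s\<bar> \<le> d * \<bar>y - s\<bar>"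
      by (intro mult_right_mono) auto
    then show ?case
      by (simp add: power2_eq_square mult.assoc flip: abs_mult)
  qed
qed

section \<open>The scalar equation along a ray\<close>

text \<open>The equation along a ray is \<open>max {G (\<phi>'' s) (\<phi>' s / s) - w s, h (\<phi>' s)} = 0\<close>, where
  \<open>G a b\<close> is the value of \<open>F\<close> at the Hessian with radial eigenvalue \<open>a\<close> and tangential
  eigenvalues \<open>b\<close>, \<open>w\<close> is \<open>f - \<mu>\<close>, and \<open>h\<close> is \<open>H\<close>.\<close>
locale radial_equation =
  fixes \<theta> \<Theta> K :: real and G :: "real \<Rightarrow> real \<Rightarrow> real" and h w :: "real \<Rightarrow> real"
  assumes \<theta>_pos: "0 < \<theta>" and \<Theta>_nonneg: "0 \<le> \<Theta>"
    and G_upper: "\<And>a b c. 0 \<le> c \<Longrightarrow> G (a + c) b \<le> G a b - \<theta> * c"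
    and G_lower: "\<And>a b c. 0 \<le> c \<Longrightarrow> G a b - \<Theta> * c \<le> G (a + c) b"
    and G_antimono: "\<And>a b b'. b \<le> b' \<Longrightarrow> G a b' \<le> G a b"
    and G_lower_tangential: "\<And>a b b'. b \<le> b' \<Longrightarrow> G a b - K * (b' - b) \<le> G a b'"
    and h_cont: "continuous_on UNIV h" and h_0: "h 0 < 0"
    and h_ray: "\<And>p q. h q \<le> 0 \<Longrightarrow> 0 \<le> p \<Longrightarrow> p < q \<Longrightarrow> h p < 0"
    and w_cont: "continuous_on UNIV w"
begin

text \<open>The one-sided bounds combine into Lipschitz estimates in each argument, with constants
  \<open>\<Theta>\<close> and \<open>K\<close>.\<close>

lemma tendsto_G:
  assumes "(\<alpha> \<longlongrightarrow> a) A" "(\<beta> \<longlongrightarrow> b) A"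
  shows "((\<lambda>x. G (\<alpha> x) (\<beta> x)) \<longlongrightarrow> G a b) A"
proof -
  have 1: "\<bar>G x c - G y c\<bar> \<le> \<Theta> * \<bar>x - y\<bar>" for x y c
  proof (induction x y rule: linorder_wlog)
    case (le x y)
    then show ?case
      using G_upper[of "y - x" x c] G_lower[of "y - x" x c]
        mult_nonneg_nonneg[OF less_imp_le[OF \<theta>_pos], of "y - x"]
        mult_nonneg_nonneg[OF \<Theta>_nonneg, of "y - x"] by (simp add: abs_le_iff)
  next
    case (sym x y)
    then show ?case
      by (simp add: abs_minus_commute)
  qed
  have 2: "\<bar>G c x - G c y\<bar> \<le> K * \<bar>x - y\<bar>" for x y c
  proof (induction x y rule: linorder_wlog)
    case (le x y)
    then show ?case
      using G_antimono[of x y c] G_lower_tangential[of x y c] by (simp add: algebra_simps abs_if)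
  next
    case (sym x y)
    then show ?case
      by (simp add: abs_minus_commute)
  qed
  have "norm (G (\<alpha> x) (\<beta> x) - G a b) \<le> \<Theta> * \<bar>\<alpha> x - a\<bar> + K * \<bar>\<beta> x - b\<bar>" for x
    using 1[of "\<alpha> x" "\<beta> x" a] 2[of a "\<beta> x" b] by simp
  then have "\<forall>\<^sub>F x in A. norm (G (\<alpha> x) (\<beta> x) - G a b) \<le> \<Theta> * \<bar>\<alpha> x - a\<bar> + K * \<bar>\<beta> x - b\<bar>"
    by simp
  moreover have "((\<lambda>x. \<Theta> * \<bar>\<alpha> x - a\<bar> + K * \<bar>\<beta> x - b\<bar>) \<longlongrightarrow> \<Theta> * \<bar>a - a\<bar> + K * \<bar>b - b\<bar>) A"
    by (intro tendsto_intros assms)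
  then have "((\<lambda>x. \<Theta> * \<bar>\<alpha> x - a\<bar> + K * \<bar>\<beta> x - b\<bar>) \<longlongrightarrow> 0) A"
    by simp
  ultimately have "((\<lambda>x. G (\<alpha> x) (\<beta> x) - G a b) \<longlongrightarrow> 0) A"
    by (rule Lim_null_comparison)
  then show ?thesis
    by (simp add: LIM_zero_iff)
qed

text \<open>By ellipticity \<open>G\<close> drops by at least \<open>\<theta> * r\<close> on each of
  \<open>{- r..0}\<close> and \<open>{0..r}\<close>; \<open>r\<close> is chosen so that its end
  values enclose \<open>v\<close>.\<close>

lemma G_root: obtains k where "G k b = v"
proof -
  have cont: "continuous_on S (\<lambda>a. G a b)" for S
    by (auto simp: continuous_on_def intro!: tendsto_G tendsto_ident_at)
  define r where "r = \<bar>G 0 b - v\<bar> / \<theta>"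
  have r: "0 \<le> r" "\<theta> * r = \<bar>G 0 b - v\<bar>"
    using \<theta>_pos by (auto simp: r_def)
  have "G r b \<le> v" "v \<le> G (- r) b"
    using G_upper[of r 0 b] G_upper[of r "- r" b] r by auto
  then show thesis
    using IVT2'[of "\<lambda>a. G a b" r v "- r", OF _ _ _ cont] r(1) that by auto
qed

lemma eventually_h_neg:
  fixes \<psi> :: "real \<Rightarrow> real"
  assumes "isCont \<psi> s" "h (\<psi> s) < 0"
  shows "\<forall>\<^sub>F t in nhds s. h (\<psi> t) < 0"
proof -
  have "(\<psi> \<longlongrightarrow> \<psi> s) (nhds s)"
    using assms(1) by (simp only: isCont_def tendsto_at_iff_tendsto_nhds)
  then have "((\<lambda>t. h (\<psi> t)) \<longlongrightarrow> h (\<psi> s)) (nhds s)"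
    by (rule continuous_on_tendsto_compose[OF h_cont]) auto
  then show ?thesis
    using assms(2) by (rule order_tendstoD(2))
qed

end

text \<open>The viscosity conditions for even quartic test functions, whose slope at
  \<open>t\<close> is \<open>2 * c1 * t\<close> and whose tangential eigenvalue is therefore
  \<open>2 * c1\<close>. The supersolution condition includes \<open>t = 0\<close>, where it
  excludes a kink at the origin.\<close>

locale radial_solution = radial_equation +
  fixes \<phi> :: "real \<Rightarrow> real"
  assumes convex: "convex_on UNIV \<phi>" and even: "\<And>s. \<phi> (- s) = \<phi> s"
    and sub: "\<And>t c1 c2. 0 < t \<Longrightarrow>
      \<forall>\<^sub>F s in nhds t. \<phi> s - (c1 * s\<^sup>2 + c2 * (s\<^sup>2 - t\<^sup>2)\<^sup>2) \<le> \<phi> t - c1 * t\<^sup>2 \<Longrightarrow>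
      G (2 * c1 + 8 * c2 * t\<^sup>2) (2 * c1) \<le> w t \<and> h (2 * c1 * t) \<le> 0"
    and super: "\<And>t c1 c2. 0 \<le> t \<Longrightarrow>
      \<forall>\<^sub>F s in nhds t. \<phi> t - c1 * t\<^sup>2 \<le> \<phi> s - (c1 * s\<^sup>2 + c2 * (s\<^sup>2 - t\<^sup>2)\<^sup>2) \<Longrightarrow>
      w t \<le> G (2 * c1 + 8 * c2 * t\<^sup>2) (2 * c1) \<or> 0 \<le> h (2 * c1 * t)"
begin

text \<open>The quartic needs a second derivative \<open>X'\<close> strictly above \<open>X\<close>;
  continuity of \<open>G\<close> closes the gap as \<open>X'\<close> decreases to
  \<open>X\<close>.\<close>

lemma touching_above:
  assumes t: "0 < t" and ev: "\<forall>\<^sub>F s in nhds t. \<phi> s \<le> \<phi> t + p * (s - t) + X / 2 * (s - t)\<^sup>2"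
  shows "G X (p / t) \<le> w t" and "h p \<le> 0"
proof -
  have *: "G X' (p / t) \<le> w t \<and> h p \<le> 0" if "X < X'" for X'
    using sub[OF t quartic_touching_above[OF _ that ev]] t by (simp add: field_simps)
  then show "h p \<le> 0"
    using gt_ex by blast
  have "((\<lambda>X'. G X' (p / t)) \<longlongrightarrow> G X (p / t)) (at_right X)"
    by (intro tendsto_G tendsto_intros)
  then show "G X (p / t) \<le> w t"
    by (rule tendsto_upperbound) (use * in \<open>auto simp: eventually_at_filter\<close>)
qed

lemma touching_below:
  assumes t: "0 < t" and ev: "\<forall>\<^sub>F s in nhds t. \<phi> t + p * (s - t) + X / 2 * (s - t)\<^sup>2 \<le> \<phi> s"
    and "h p < 0"
  shows "w t \<le> G X (p / t)"
proof -
  have *: "w t \<le> G X' (p / t)" if "X' < X" for X'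
    using super[OF less_imp_le[OF t] quartic_touching_below[OF _ that ev]] t assms(3)
    by (simp add: field_simps)
  have "((\<lambda>X'. G X' (p / t)) \<longlongrightarrow> G X (p / t)) (at_left X)"
    by (intro tendsto_G tendsto_intros)
  then show ?thesis
    by (rule tendsto_lowerbound) (use * in \<open>auto simp: eventually_at_filter\<close>)
qed

section \<open>Subgradients of the profile and continuity of its slope\<close>

definition subgradient :: "real \<Rightarrow> real \<Rightarrow> bool" where
  "subgradient s p \<longleftrightarrow> (\<forall>y. \<phi> s + p * (y - s) \<le> \<phi> y)"

text \<open>An arbitrary choice for now; subgradients prove unique for \<open>0 \<le> s\<close>, and
  there this is the derivative of \<open>\<phi>\<close>.\<close>

definition \<psi> :: "real \<Rightarrow> real" where
  "\<psi> s = (SOME p. subgradient s p)"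

lemma subgradient_\<psi>: "subgradient s (\<psi> s)"
proof -
  have "\<exists>p. subgradient s p"
    using convex_le_Inf_differential[OF convex, of s] unfolding subgradient_def by auto
  then show ?thesis
    unfolding \<psi>_def by (rule someI_ex)
qed

lemma subgradient_mono:
  assumes "subgradient s p" "subgradient t q" "s < t"
  shows "p \<le> q"
proof -
  have "\<phi> s + p * (t - s) \<le> \<phi> t" "\<phi> t + q * (s - t) \<le> \<phi> s"
    using assms by (auto simp: subgradient_def)
  then have "p * (t - s) \<le> q * (t - s)"
    by (simp add: algebra_simps)
  then show ?thesis
    using assms(3) by simp
qed

lemma \<phi>_cont: "continuous_on S \<phi>"
  using convex_on_continuous[OF open_UNIV convex] continuous_on_subset by blast

text \<open>At a kink no smooth function touches a convex one from above, so the constraint cannot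
  be read off at \<open>s\<close> itself. It is read off at some \<open>t > s\<close> where a
  parabola touches from above, and monotonicity of subgradients compares the slopes.\<close>

lemma subgradient_le_feasible:
  assumes "0 \<le> s" "subgradient s p"
  obtains q where "p \<le> q" "h q \<le> 0"
proof -
  define c where "c = s + 1"
  \<comment> \<open>So large that \<open>?g\<close> at the midpoint \<open>c\<close> exceeds its
    values at both ends of \<open>{s..s + 2}\<close>; the maximum is then interior.\<close>
  define X where "X = 2 * (\<bar>\<phi> s\<bar> + \<bar>\<phi> (s + 2)\<bar> + \<bar>\<phi> c\<bar> + 1)"
  let ?g = "\<lambda>t. \<phi> t - X / 2 * (t - c)\<^sup>2"
  have "continuous_on {s..s + 2} ?g"
    by (intro continuous_intros \<phi>_cont)
  then obtain t where t: "t \<in> {s..s + 2}" and max: "\<And>y. y \<in> {s..s + 2} \<Longrightarrow> ?g y \<le> ?g t"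
    using continuous_attains_sup[of "{s..s + 2}" ?g] by auto
  have "X / 2 = \<bar>\<phi> s\<bar> + \<bar>\<phi> (s + 2)\<bar> + \<bar>\<phi> c\<bar> + 1"
    by (simp add: X_def)
  moreover have sq: "(s - c)\<^sup>2 = 1" "(s + 2 - c)\<^sup>2 = 1" "(c - c)\<^sup>2 = 0"
    by (simp_all add: c_def)
  ultimately have "?g s < ?g c" "?g (s + 2) < ?g c"
    unfolding sq by linarith+
  moreover have "?g c \<le> ?g t"
    by (rule max) (simp add: c_def)
  ultimately have st: "s < t" "t < s + 2"
    using t by (auto simp: less_le)
  define P where "P = X * (t - c)"
  have "\<forall>\<^sub>F y in nhds t. y \<in> {s<..<s + 2}"
    using st by (intro eventually_nhds_in_open) auto
  then have ev: "\<forall>\<^sub>F y in nhds t. \<phi> y \<le> \<phi> t + P * (y - t) + X / 2 * (y - t)\<^sup>2"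
  proof eventually_elim
    case (elim y)
    then have "?g y \<le> ?g t"
      by (intro max) auto
    moreover have "X / 2 * (y - c)\<^sup>2 - X / 2 * (t - c)\<^sup>2 = P * (y - t) + X / 2 * (y - t)\<^sup>2"
      by (simp add: P_def power2_eq_square field_simps)
    ultimately show ?case
      by linarith
  qed
  \<comment> \<open>The parabola lies above \<open>\<phi>\<close>, the supporting line below, and
    both meet it at \<open>t\<close>; their difference has a local minimum there, so the slopes
    agree.\<close>
  then have "\<forall>\<^sub>F y in nhds t. 0 \<le> (P - \<psi> t) * (y - t) + X / 2 * (y - t)\<^sup>2"
  proof eventually_elim
    case (elim y)
    then show ?case
      using subgradient_\<psi>[of t] unfolding subgradient_def by (smt (verit) left_diff_distrib)
  qed
  then obtain d where d: "d > 0"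
    "\<And>y. \<bar>t - y\<bar> < d \<Longrightarrow> 0 \<le> (P - \<psi> t) * (y - t) + X / 2 * (y - t)\<^sup>2"
    by (auto simp: eventually_nhds_metric dist_real_def abs_minus_commute)
  have "((\<lambda>y. (P - \<psi> t) * (y - t) + X / 2 * (y - t)\<^sup>2) has_real_derivative P - \<psi> t) (at t)"
    by (auto intro!: derivative_eq_intros)
  then have "P - \<psi> t = 0"
    by (rule DERIV_local_min[OF _ d(1)]) (use d(2) in auto)
  then have "p \<le> P"
    using subgradient_mono[OF assms(2) subgradient_\<psi> st(1)] by simp
  moreover have "h P \<le> 0"
    using touching_above(2)[OF _ ev] st assms(1) by simp
  ultimately show thesis
    using that by blast
qed

lemma subgradient_0_minus: "subgradient 0 p \<Longrightarrow> subgradient 0 (- p)"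
  unfolding subgradient_def by (metis even minus_mult_commute diff_zero)

lemma subgradient_0_0: "subgradient 0 0"
  unfolding subgradient_def
proof
  fix y
  have "\<phi> ((1 - 1 / 2) *\<^sub>R y + (1 / 2) *\<^sub>R (- y)) \<le> (1 - 1 / 2) * \<phi> y + 1 / 2 * \<phi> (- y)"
    by (rule convex_onD[OF convex]) auto
  then show "\<phi> 0 + 0 * (y - 0) \<le> \<phi> y"
    by (simp add: even)
qed

lemma G_unbounded: obtains X where "0 \<le> X" "G X b < v"
proof
  let ?X = "(\<bar>G 0 b - v\<bar> + 1) / \<theta>"
  show "0 \<le> ?X"
    using \<theta>_pos by simp
  then have "G (0 + ?X) b \<le> G 0 b - \<theta> * ?X"
    by (rule G_upper)
  then show "G ?X b < v"
    using \<theta>_pos by simp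
qed

text \<open>By evenness \<open>- p\<close> is a subgradient too, so a nonzero \<open>p\<close> puts
  \<open>\<phi>\<close> above a cusp at 0. A steep parabola fits under it with slope 0, where the
  constraint is inactive, and its Hessian, \<open>X\<close> times the identity, violates the
  supersolution condition.\<close>

lemma subgradient_unique_0: "p = 0" if "subgradient 0 p"
proof (rule ccontr)
  assume "p \<noteq> 0"
  obtain X where X: "0 \<le> X" "G X 0 < w 0"
    by (rule G_unbounded)
  have "\<forall>\<^sub>F y in nhds 0. X / 2 * (y - 0)\<^sup>2 \<le> \<bar>p\<bar> * \<bar>y - 0\<bar>"
    using \<open>p \<noteq> 0\<close> by (intro parabola_below_cusp) simp
  then have "\<forall>\<^sub>F y in nhds 0. \<phi> 0 - X / 2 * 0\<^sup>2 \<le> \<phi> y - (X / 2 * y\<^sup>2 + 0 * (y\<^sup>2 - 0\<^sup>2)\<^sup>2)"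
  proof eventually_elim
    case (elim y)
    have "\<phi> 0 + p * y \<le> \<phi> y" "\<phi> 0 - p * y \<le> \<phi> y"
      using that subgradient_0_minus[OF that] by (auto simp: subgradient_def)
    moreover have "\<bar>p\<bar> * \<bar>y\<bar> = p * y \<or> \<bar>p\<bar> * \<bar>y\<bar> = - (p * y)"
      by (auto simp: abs_if)
    ultimately show ?case
      using elim by auto
  qed
  from super[OF order_refl this] have "w 0 \<le> G X X"
    using h_0 by simp
  also have "G X X \<le> G X 0"
    using X by (intro G_antimono)
  finally show False
    using X by simp
qed

text \<open>At a kink every slope strictly between two subgradients, with an arbitrarily large second
  derivative, is attained by a function touching from below; uniform ellipticity excludes this.\<close>
lemma subgradient_not_less:
  assumes "0 < s" "subgradient s p" "subgradient s q"
  shows "\<not> p < q"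
proof
  assume "p < q"
  define m where "m = (p + q) / 2"
  have "0 \<le> p"
    using subgradient_mono[OF subgradient_0_0 assms(2,1)] .
  \<comment> \<open>The intermediate slope \<open>m\<close> lies strictly below a feasible slope
    \<open>q'\<close>, so the constraint is inactive at \<open>m\<close>.\<close>
  obtain q' where "q \<le> q'" "h q' \<le> 0"
    using subgradient_le_feasible[OF _ assms(3)] assms(1) by auto
  then have "h m < 0"
    using \<open>0 \<le> p\<close> \<open>p < q\<close> by (intro h_ray[of q']) (auto simp: m_def)
  obtain X where X: "0 \<le> X" "G X (m / s) < w s"
    by (rule G_unbounded)
  have "\<forall>\<^sub>F y in nhds s. X / 2 * (y - s)\<^sup>2 \<le> (q - p) / 2 * \<bar>y - s\<bar>"
    using \<open>p < q\<close> by (intro parabola_below_cusp) simp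
  then have "\<forall>\<^sub>F y in nhds s. \<phi> s + m * (y - s) + X / 2 * (y - s)\<^sup>2 \<le> \<phi> y"
  proof eventually_elim
    case (elim y)
    have "\<phi> s + p * (y - s) \<le> \<phi> y" "\<phi> s + q * (y - s) \<le> \<phi> y"
      using assms by (auto simp: subgradient_def)
    moreover have "m * (y - s) + (q - p) / 2 * \<bar>y - s\<bar> = p * (y - s) \<or>
        m * (y - s) + (q - p) / 2 * \<bar>y - s\<bar> = q * (y - s)"
      by (auto simp: m_def abs_if field_simps)
    ultimately show ?case
      using elim by auto
  qed
  from touching_below[OF assms(1) this \<open>h m < 0\<close>] X show False
    by simp
qed

lemma subgradient_unique: "0 \<le> s \<Longrightarrow> subgradient s p \<Longrightarrow> p = \<psi> s"
  using subgradient_unique_0 subgradient_not_less subgradient_\<psi>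
  by (metis less_eq_real_def linorder_less_linear)

lemma \<psi>_0: "\<psi> 0 = 0"
  using subgradient_unique subgradient_0_0 by fastforce

lemma \<psi>_mono: "s \<le> t \<Longrightarrow> \<psi> s \<le> \<psi> t"
  using subgradient_mono[OF subgradient_\<psi> subgradient_\<psi>] by (cases "s = t") auto

lemma \<psi>_nonneg: "0 \<le> s \<Longrightarrow> 0 \<le> \<psi> s"
  using \<psi>_mono[of 0 s] \<psi>_0 by simp

lemma h_\<psi>:
  assumes "0 \<le> s" shows "h (\<psi> s) \<le> 0"
proof -
  obtain q where "\<psi> s \<le> q" "h q \<le> 0"
    using subgradient_le_feasible[OF assms subgradient_\<psi>] .
  then show ?thesis
    using h_ray[of q "\<psi> s"] \<psi>_nonneg[OF assms] by (cases "\<psi> s = q") auto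
qed

text \<open>No jump to the right: otherwise \<open>q\<close> is a lower bound for the slopes right
  of \<open>s\<close>, and letting \<open>t\<close> decrease to \<open>s\<close> makes
  \<open>q\<close> a second subgradient at \<open>s\<close>.\<close>

lemma ex_\<psi>_less:
  assumes "0 \<le> s" "\<psi> s < q" shows "\<exists>t>s. \<psi> t < q"
proof (rule ccontr)
  assume "\<not> ?thesis"
  then have ge: "\<And>t. s < t \<Longrightarrow> q \<le> \<psi> t"
    by force
  have "subgradient s q"
    unfolding subgradient_def
  proof
    fix y
    show "\<phi> s + q * (y - s) \<le> \<phi> y"
    proof (cases "y \<le> s")
      case True
      then have "q * (y - s) \<le> \<psi> s * (y - s)"
        using assms by (intro mult_right_mono_neg) auto
      then show ?thesis
        using subgradient_\<psi>[of s] unfolding subgradient_def by (smt (verit))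
    next
      case False
      have "\<phi> t + q * (y - t) \<le> \<phi> y" if "s < t" "t < y" for t
      proof -
        have "q * (y - t) \<le> \<psi> t * (y - t)"
          using that by (intro mult_right_mono ge) auto
        then show ?thesis
          using subgradient_\<psi>[of t] unfolding subgradient_def by (smt (verit))
      qed
      then have "\<forall>\<^sub>F t in at_right s. \<phi> t + q * (y - t) \<le> \<phi> y"
        using False by (subst eventually_at_right[of s y]) (auto intro!: exI[of _ y])
      moreover have "(\<phi> \<longlongrightarrow> \<phi> s) (at_right s)"
        using \<phi>_cont[of UNIV] by (simp add: continuous_on_eq_continuous_at isCont_def
            filterlim_at_split)
      then have "((\<lambda>t. \<phi> t + q * (y - t)) \<longlongrightarrow> \<phi> s + q * (y - s)) (at_right s)"
        by (intro tendsto_intros)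
      ultimately show ?thesis
        by (intro tendsto_upperbound) auto
    qed
  qed
  then show False
    using subgradient_unique[OF assms(1)] assms(2) by auto
qed

text \<open>No jump from the left, by the mirrored limit.\<close>

lemma ex_less_\<psi>:
  assumes "0 \<le> s" "q < \<psi> s" shows "\<exists>t<s. q < \<psi> t"
proof (rule ccontr)
  assume "\<not> ?thesis"
  then have le: "\<And>t. t < s \<Longrightarrow> \<psi> t \<le> q"
    by force
  have "subgradient s q"
    unfolding subgradient_def
  proof
    fix y
    show "\<phi> s + q * (y - s) \<le> \<phi> y"
    proof (cases "s \<le> y")
      case True
      then have "q * (y - s) \<le> \<psi> s * (y - s)"
        using assms by (intro mult_right_mono) auto
      then show ?thesis
        using subgradient_\<psi>[of s] unfolding subgradient_def by (smt (verit))
    next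
      case False
      have "\<phi> t + q * (y - t) \<le> \<phi> y" if "t < s" "y < t" for t
      proof -
        have "q * (y - t) \<le> \<psi> t * (y - t)"
          using that by (intro mult_right_mono_neg le) auto
        then show ?thesis
          using subgradient_\<psi>[of t] unfolding subgradient_def by (smt (verit))
      qed
      then have "\<forall>\<^sub>F t in at_left s. \<phi> t + q * (y - t) \<le> \<phi> y"
        using False by (subst eventually_at_left[of y s]) (auto intro!: exI[of _ y])
      moreover have "(\<phi> \<longlongrightarrow> \<phi> s) (at_left s)"
        using \<phi>_cont[of UNIV] by (simp add: continuous_on_eq_continuous_at isCont_def
            filterlim_at_split)
      then have "((\<lambda>t. \<phi> t + q * (y - t)) \<longlongrightarrow> \<phi> s + q * (y - s)) (at_left s)"
        by (intro tendsto_intros)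
      ultimately show ?thesis
        by (intro tendsto_upperbound) auto
    qed
  qed
  then show False
    using subgradient_unique[OF assms(1)] assms(2) by auto
qed

lemma isCont_\<psi>:
  assumes "0 \<le> s" shows "isCont \<psi> s"
  unfolding isCont_def
proof (rule order_tendstoI)
  fix q assume "q < \<psi> s"
  then obtain t where "t < s" "q < \<psi> t"
    using ex_less_\<psi>[OF assms] by auto
  then have "q < \<psi> y" if "t < y" for y
    using \<psi>_mono[of t y] that by simp
  moreover have "\<forall>\<^sub>F y in at s. t < y"
    using \<open>t < s\<close> by (rule order_tendstoD(1)[OF tendsto_ident_at])
  ultimately show "\<forall>\<^sub>F y in at s. q < \<psi> y"
    by (auto elim: eventually_mono)
next
  fix q assume "\<psi> s < q"
  then obtain t where "s < t" "\<psi> t < q"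
    using ex_\<psi>_less[OF assms] by auto
  then have "\<psi> y < q" if "y < t" for y
    using \<psi>_mono[of y t] that by simp
  moreover have "\<forall>\<^sub>F y in at s. y < t"
    using \<open>s < t\<close> by (rule order_tendstoD(2)[OF tendsto_ident_at])
  ultimately show "\<forall>\<^sub>F y in at s. \<psi> y < q"
    by (auto elim: eventually_mono)
qed

text \<open>The subgradient inequalities at \<open>s\<close> and \<open>y\<close> squeeze the
  difference quotient between \<open>\<psi> s\<close> and \<open>\<psi> y\<close>.\<close>

lemma \<phi>_deriv: "(\<phi> has_real_derivative \<psi> s) (at s)" if "0 \<le> s"
  unfolding has_field_derivative_iff
proof -
  have "norm ((\<phi> y - \<phi> s) / (y - s) - \<psi> s) \<le> \<bar>\<psi> y - \<psi> s\<bar>" if "y \<noteq> s" for y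
  proof -
    have 1: "\<psi> s * (y - s) \<le> \<phi> y - \<phi> s" and 2: "\<phi> y - \<phi> s \<le> \<psi> y * (y - s)"
      using subgradient_\<psi>[of s] subgradient_\<psi>[of y] unfolding subgradient_def
      by (auto simp: algebra_simps dest: spec[of _ y] spec[of _ s])
    have "\<bar>(\<phi> y - \<phi> s) / (y - s) - \<psi> s\<bar> = \<bar>\<phi> y - \<phi> s - \<psi> s * (y - s)\<bar> / \<bar>y - s\<bar>"
      using that by (simp add: field_simps flip: abs_divide)
    also have "\<dots> \<le> \<bar>(\<psi> y - \<psi> s) * (y - s)\<bar> / \<bar>y - s\<bar>"
      using 1 2 by (intro divide_right_mono) (auto simp: left_diff_distrib)
    also have "\<dots> = \<bar>\<psi> y - \<psi> s\<bar>"
      using that by (simp add: abs_mult)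
    finally show ?thesis
      by simp
  qed
  then have "\<forall>\<^sub>F y in at s. norm ((\<phi> y - \<phi> s) / (y - s) - \<psi> s) \<le> \<bar>\<psi> y - \<psi> s\<bar>"
    by (auto simp: eventually_at_filter)
  moreover have "((\<lambda>y. \<bar>\<psi> y - \<psi> s\<bar>) \<longlongrightarrow> 0) (at s)"
    using isCont_\<psi>[OF that] unfolding isCont_def by (simp add: LIM_zero_iff tendsto_rabs_zero)
  ultimately have "((\<lambda>y. (\<phi> y - \<phi> s) / (y - s) - \<psi> s) \<longlongrightarrow> 0) (at s)"
    by (rule Lim_null_comparison)
  then show "((\<lambda>y. (\<phi> y - \<phi> s) / (y - s)) \<longlongrightarrow> \<psi> s) (at s)"
    by (simp add: LIM_zero_iff)
qed

section \<open>The second derivative: from viscosity to classical sense\<close>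

lemma \<psi>_increment_le:
  assumes "0 < a" "a \<le> b"
    and "\<And>t. a < t \<Longrightarrow> t < b \<Longrightarrow> h (\<psi> t) < 0 \<and> G X (\<psi> t / t) < w t"
  shows "\<psi> b - X * b \<le> \<psi> a - X * a"
proof (rule ccontr)
  assume "\<not> ?thesis"
  \<comment> \<open>With \<open>\<beta>\<close> strictly in between, \<open>\<psi> t\<close> passes
    from below the line \<open>X * t + \<beta>\<close> to above it. An interior minimum of
    \<open>?g\<close> is then a point where a parabola of second derivative \<open>X\<close> touches
    \<open>\<phi>\<close> from below.\<close>
  then obtain \<beta> where \<beta>: "\<psi> a - X * a < \<beta>" "\<beta> < \<psi> b - X * b"
    unfolding not_le using dense by blast
  let ?g = "\<lambda>t. \<phi> t - (X / 2 * t\<^sup>2 + \<beta> * t)"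
  have "(?g has_real_derivative \<psi> t - (X * t + \<beta>)) (at t)" if "a \<le> t" for t
    using \<phi>_deriv[of t] assms(1) that by (auto intro!: derivative_eq_intros)
  moreover have "a < b"
    using assms(2) \<beta> by (cases "a = b") auto
  ultimately obtain t where t: "a < t" "t < b" "\<psi> t - (X * t + \<beta>) = 0"
    and ev: "\<forall>\<^sub>F y in nhds t. ?g t \<le> ?g y"
    using \<beta> by (elim interior_min_of_derivative_signs[of a b ?g "\<lambda>t. \<psi> t - (X * t + \<beta>)"]) auto
  from t(3) have "\<psi> t = X * t + \<beta>"
    by simp
  then have eq: "X / 2 * y\<^sup>2 + \<beta> * y - (X / 2 * t\<^sup>2 + \<beta> * t) = \<psi> t * (y - t) + X / 2 * (y - t)\<^sup>2" for y
    by (simp add: power2_eq_square field_simps)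
  have "\<forall>\<^sub>F y in nhds t. \<phi> t + \<psi> t * (y - t) + X / 2 * (y - t)\<^sup>2 \<le> \<phi> y"
    using ev
  proof eventually_elim
    case (elim y)
    then show ?case
      using eq[of y] by linarith
  qed
  then show False
    using touching_below[of t "\<psi> t" X] t assms by force
qed

text \<open>The mirror image, with touching from above. A subsolution obeys the elliptic inequality
  wherever it is touched, so the hypothesis concerns \<open>G\<close> alone.\<close>

lemma \<psi>_increment_ge:
  assumes "0 < a" "a \<le> b" and "\<And>t. a < t \<Longrightarrow> t < b \<Longrightarrow> w t < G X (\<psi> t / t)"
  shows "\<psi> a - X * a \<le> \<psi> b - X * b"
proof (rule ccontr)
  assume "\<not> ?thesis"
  then obtain \<beta> where \<beta>: "\<psi> b - X * b < \<beta>" "\<beta> < \<psi> a - X * a"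
    unfolding not_le using dense by blast
  let ?g = "\<lambda>t. (X / 2 * t\<^sup>2 + \<beta> * t) - \<phi> t"
  have "(?g has_real_derivative (X * t + \<beta>) - \<psi> t) (at t)" if "a \<le> t" for t
    using \<phi>_deriv[of t] assms(1) that by (auto intro!: derivative_eq_intros)
  moreover have "a < b"
    using assms(2) \<beta> by (cases "a = b") auto
  ultimately obtain t where t: "a < t" "t < b" "(X * t + \<beta>) - \<psi> t = 0"
    and ev: "\<forall>\<^sub>F y in nhds t. ?g t \<le> ?g y"
    using \<beta> by (elim interior_min_of_derivative_signs[of a b ?g "\<lambda>t. (X * t + \<beta>) - \<psi> t"]) auto
  from t(3) have "\<psi> t = X * t + \<beta>"
    by simp
  then have eq: "X / 2 * y\<^sup>2 + \<beta> * y - (X / 2 * t\<^sup>2 + \<beta> * t) = \<psi> t * (y - t) + X / 2 * (y - t)\<^sup>2" for y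
    by (simp add: power2_eq_square field_simps)
  have "\<forall>\<^sub>F y in nhds t. \<phi> y \<le> \<phi> t + \<psi> t * (y - t) + X / 2 * (y - t)\<^sup>2"
    using ev
  proof eventually_elim
    case (elim y)
    then show ?case
      using eq[of y] by linarith
  qed
  then show False
    using touching_above(1)[of t "\<psi> t" X] t assms by force
qed

text \<open>Since \<open>\<psi>\<close> is continuous, the viscosity equation reads \<open>\<phi>'' = k\<close> with a continuous right-hand
  side, and therefore holds classically.\<close>
lemma classical_solution:
  assumes s: "0 < s" and "h (\<psi> s) < 0"
  obtains k where "(\<psi> has_real_derivative k) (at s)" "G k (\<psi> s / s) = w s"
proof -
  obtain k where k: "G k (\<psi> s / s) = w s"
    by (rule G_root)
  have \<psi>_lim: "(\<psi> \<longlongrightarrow> \<psi> s) (nhds s)"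
    using isCont_\<psi>[of s] s by (simp add: isCont_def tendsto_at_iff_tendsto_nhds)
  have G_lim: "((\<lambda>t. G X (\<psi> t / t) - w t) \<longlongrightarrow> G X (\<psi> s / s) - w s) (nhds s)" for X
  proof (intro tendsto_diff tendsto_G tendsto_divide \<psi>_lim tendsto_const filterlim_ident)
    show "(w \<longlongrightarrow> w s) (nhds s)"
      using w_cont by (simp add: continuous_on_eq_continuous_at isCont_def
          tendsto_at_iff_tendsto_nhds)
  qed (use s in auto)
  have "((\<lambda>t. (\<psi> t - \<psi> s) / (t - s)) \<longlongrightarrow> k) (at s)"
  proof (rule order_tendstoI)
    fix q assume "k < q"
    \<comment> \<open>Strictly between \<open>k\<close> and \<open>q\<close>: ellipticity gives
      \<open>G X (\<psi> s / s) < w s\<close>, which persists near \<open>s\<close> by continuity,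
      so the increments of \<open>\<psi>\<close> there have slope at most \<open>X\<close>.\<close>
    define X where "X = (k + q) / 2"
    have X: "k < X" "X < q"
      using \<open>k < q\<close> by (auto simp: X_def)
    have "G X (\<psi> s / s) - w s < 0"
      using G_upper[of "X - k" k "\<psi> s / s"] k X mult_pos_pos[OF \<theta>_pos, of "X - k"] by auto
    then have "\<forall>\<^sub>F t in nhds s. G X (\<psi> t / t) - w t < 0 \<and> h (\<psi> t) < 0 \<and> 0 < t"
      using s assms(2) by (intro eventually_conj order_tendstoD(2)[OF G_lim] eventually_h_neg isCont_\<psi>
          order_tendstoD(1)[OF filterlim_ident]) auto
    then obtain d where d: "d > 0"
      "\<And>t. \<bar>t - s\<bar> < d \<Longrightarrow> G X (\<psi> t / t) - w t < 0 \<and> h (\<psi> t) < 0 \<and> 0 < t"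
      by (auto simp: eventually_nhds_metric dist_real_def)
    have "(\<psi> t - \<psi> s) / (t - s) < q" if "\<bar>t - s\<bar> < d" "t \<noteq> s" for t
    proof -
      have "(\<psi> t - \<psi> s) / (t - s) \<le> X"
      proof (cases "t < s")
        case True
        have "\<psi> s - X * s \<le> \<psi> t - X * t"
          by (rule \<psi>_increment_le) (use True that d(2) in \<open>auto simp: abs_if\<close>)
        then show ?thesis
          using True by (simp add: field_simps)
      next
        case False
        have "\<psi> t - X * t \<le> \<psi> s - X * s"
          by (rule \<psi>_increment_le) (use s False that d(2) in \<open>auto simp: abs_if\<close>)
        then show ?thesis
          using False that by (simp add: field_simps)
      qed
      with X show ?thesis
        by simp
    qed
    then show "\<forall>\<^sub>F t in at s. (\<psi> t - \<psi> s) / (t - s) < q"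
      using d(1) by (auto simp: eventually_at dist_real_def)
  next
    fix q assume "q < k"
    define X where "X = (k + q) / 2"
    have X: "X < k" "q < X"
      using \<open>q < k\<close> by (auto simp: X_def)
    have "0 < G X (\<psi> s / s) - w s"
      using G_upper[of "k - X" X "\<psi> s / s"] k X mult_pos_pos[OF \<theta>_pos, of "k - X"] by auto
    then have "\<forall>\<^sub>F t in nhds s. 0 < G X (\<psi> t / t) - w t \<and> 0 < t"
      using s by (intro eventually_conj order_tendstoD(1)[OF G_lim]
          order_tendstoD(1)[OF filterlim_ident]) auto
    then obtain d where d: "d > 0" "\<And>t. \<bar>t - s\<bar> < d \<Longrightarrow> 0 < G X (\<psi> t / t) - w t \<and> 0 < t"
      by (auto simp: eventually_nhds_metric dist_real_def)
    have "q < (\<psi> t - \<psi> s) / (t - s)" if "\<bar>t - s\<bar> < d" "t \<noteq> s" for t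
    proof -
      have "X \<le> (\<psi> t - \<psi> s) / (t - s)"
      proof (cases "t < s")
        case True
        have "\<psi> t - X * t \<le> \<psi> s - X * s"
          by (rule \<psi>_increment_ge) (use True that d(2) in \<open>auto simp: abs_if\<close>)
        then show ?thesis
          using True by (simp add: field_simps)
      next
        case False
        have "\<psi> s - X * s \<le> \<psi> t - X * t"
          by (rule \<psi>_increment_ge) (use s False that d(2) in \<open>auto simp: abs_if\<close>)
        then show ?thesis
          using False that by (simp add: field_simps)
      qed
      with X show ?thesis
        by simp
    qed
    then show "\<forall>\<^sub>F t in at s. q < (\<psi> t - \<psi> s) / (t - s)"
      using d(1) by (auto simp: eventually_at dist_real_def)
  qed
  then show thesis
    using that k by (simp add: has_field_derivative_iff)
qed

end

subsection \<open>Comparison of profiles\<close>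

lemma radial_slope_le:
  assumes "radial_solution \<theta> \<Theta> K G h w \<phi>1" "radial_solution \<theta> \<Theta> K G h w \<phi>2" "0 \<le> s"
  shows "radial_solution.\<psi> \<phi>1 s \<le> radial_solution.\<psi> \<phi>2 s"
proof (rule ccontr)
  interpret r1: radial_solution \<theta> \<Theta> K G h w \<phi>1 by fact
  interpret r2: radial_solution \<theta> \<Theta> K G h w \<phi>2 by fact
  let ?D = "\<lambda>t. r1.\<psi> t - r2.\<psi> t"
  assume "\<not> ?thesis"
  then have Ds: "0 < ?D s"
    by simp
  have cont: "continuous_on {a..b} ?D" if "0 \<le> a" for a b
    using that by (intro continuous_at_imp_continuous_on ballI continuous_diff r1.isCont_\<psi> r2.isCont_\<psi>)
      auto
  \<comment> \<open>Compact, and nonempty because both slopes vanish at 0; its maximum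
    \<open>a\<close> is the last crossing before \<open>s\<close>.\<close>
  let ?A = "{t \<in> {0..s}. ?D t \<le> 0}"
  have "closed ?A"
    by (intro continuous_on_closed_Collect_le cont continuous_on_const) auto
  moreover have "bounded ?A"
    by (rule bounded_subset[of "{0..s}"]) auto
  ultimately have "compact ?A"
    by (simp only: compact_eq_bounded_closed)
  moreover have "0 \<in> ?A"
    using assms(3) by (simp add: r1.\<psi>_0 r2.\<psi>_0)
  ultimately obtain a where a: "a \<in> ?A" "\<And>t. t \<in> ?A \<Longrightarrow> t \<le> a"
    using compact_attains_sup[of ?A] by auto
  have pos: "0 < ?D t" if "a < t" "t \<le> s" for t
    using a(1) a(2)[of t] that by (cases "?D t \<le> 0") auto
  have "a < s"
    using a(1) Ds by (cases "a = s") auto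
  have "r1.\<psi> a < r1.\<psi> s"
    using a(1) Ds r2.\<psi>_mono[of a s] by simp
  then have "h (r1.\<psi> a) < 0"
    using r1.h_ray[of "r1.\<psi> s" "r1.\<psi> a"] r1.h_\<psi>[of s] r1.\<psi>_nonneg[of a] a(1) assms(3) by simp
  then have "\<forall>\<^sub>F t in nhds a. h (r1.\<psi> t) < 0"
    using a(1) by (intro r1.eventually_h_neg r1.isCont_\<psi>) auto
  then obtain d where d: "d > 0" "\<And>t. \<bar>t - a\<bar> < d \<Longrightarrow> h (r1.\<psi> t) < 0"
    by (auto simp: eventually_nhds_metric dist_real_def)
  \<comment> \<open>Close enough to \<open>a\<close> for the constraint to stay inactive, and not
    beyond \<open>s\<close>, so that \<open>?D\<close> is positive at \<open>b\<close>.\<close>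
  define b where "b = min s (a + d / 2)"
  have b: "a < b" "b \<le> s" "b < a + d"
    using d(1) \<open>a < s\<close> by (auto simp: b_def)
  have "?D b \<le> ?D a"
  proof (rule DERIV_nonpos_imp_decreasing_open[of a b ?D])
    fix t assume t: "a < t" "t < b"
    then have t0: "0 < t" and D: "0 < ?D t" and h1: "h (r1.\<psi> t) < 0"
      using a(1) b pos[of t] by (auto intro!: d(2))
    have h2: "h (r2.\<psi> t) < 0"
      using r1.h_ray[of "r1.\<psi> t" "r2.\<psi> t"] h1 D r2.\<psi>_nonneg t0 by simp
    obtain k1 where k1: "(r1.\<psi> has_real_derivative k1) (at t)" "G k1 (r1.\<psi> t / t) = w t"
      using r1.classical_solution[OF t0 h1] .
    obtain k2 where k2: "(r2.\<psi> has_real_derivative k2) (at t)" "G k2 (r2.\<psi> t / t) = w t"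
      using r2.classical_solution[OF t0 h2] .
    \<comment> \<open>The first profile has the larger tangential eigenvalue; a larger radial
      eigenvalue as well would push its value of \<open>G\<close> strictly below the common value
      \<open>w t\<close>.\<close>
    have "k1 \<le> k2"
    proof (rule ccontr)
      assume "\<not> ?thesis"
      then have "G k1 (r1.\<psi> t / t) < G k2 (r1.\<psi> t / t)"
        using r1.G_upper[of "k1 - k2" k2 "r1.\<psi> t / t"] mult_pos_pos[OF r1.\<theta>_pos, of "k1 - k2"]
        by simp
      also have "\<dots> \<le> G k2 (r2.\<psi> t / t)"
        using D t0 by (intro r1.G_antimono divide_right_mono) auto
      finally show False
        using k1 k2 by simp
    qed
    then show "\<exists>y. (?D has_real_derivative y) (at t) \<and> y \<le> 0"
      using DERIV_diff[OF k1(1) k2(1)] by (intro exI[of _ "k1 - k2"]) simp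
  qed (use b a(1) cont in auto)
  then show False
    using pos[of b] b a(1) by simp
qed

text \<open>Comparison in both directions equates the slopes, so the difference of the profiles has
  derivative 0.\<close>

lemma radial_solution_unique:
  assumes "radial_solution \<theta> \<Theta> K G h w \<phi>1" "radial_solution \<theta> \<Theta> K G h w \<phi>2" "0 \<le> s"
  shows "\<phi>1 s - \<phi>2 s = \<phi>1 0 - \<phi>2 0"
proof (cases "s = 0")
  case False
  interpret r1: radial_solution \<theta> \<Theta> K G h w \<phi>1 by fact
  interpret r2: radial_solution \<theta> \<Theta> K G h w \<phi>2 by fact
  have "((\<lambda>s. \<phi>1 s - \<phi>2 s) has_real_derivative 0) (at t)" if "0 \<le> t" for t
  proof -
    have "r1.\<psi> t = r2.\<psi> t"
      using radial_slope_le[OF assms(1,2) that] radial_slope_le[OF assms(2,1) that] by simp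
    then show ?thesis
      using DERIV_diff[OF r1.\<phi>_deriv r2.\<phi>_deriv, OF that that] by simp
  qed
  then show ?thesis
    using assms(3) False
    by (intro DERIV_isconst_end[where f = "\<lambda>s. \<phi>1 s - \<phi>2 s"] continuous_on_diff
        r1.\<phi>_cont r2.\<phi>_cont) auto
qed simp

subsection \<open>Reduction of the equation to a ray\<close>

text \<open>Raising the radial eigenvalue by \<open>a\<close> and the tangential ones by
  \<open>b\<close> adds a positive semidefinite matrix of trace
  \<open>a + (real CARD('n) - 1) * b\<close>; this turns the ellipticity bounds on \<open>F\<close>
  into those on \<open>G\<close>.\<close>

lemma radial_equation_of_admissible:
  fixes F :: "real^'n^'n \<Rightarrow> real" and H f :: "real^'n \<Rightarrow> real"
  assumes "admissible_operator \<theta> \<Theta> F" "\<theta> > 0" "admissible_gradient_constraint H"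
    and "convex_on UNIV f" and e: "norm e = 1"
  shows "radial_equation \<theta> \<Theta> (\<Theta> * (real CARD('n) - 1)) (\<lambda>a b. F (radial_hessian e a b))
    (\<lambda>p. H (p *\<^sub>R e)) (\<lambda>s. f (s *\<^sub>R e) - \<mu>)"
proof -
  have F: "- \<Theta> * (a + (real CARD('n) - 1) * b) \<le>
        F (radial_hessian e (a' + a) (b' + b)) - F (radial_hessian e a' b')"
      "F (radial_hessian e (a' + a) (b' + b)) - F (radial_hessian e a' b') \<le>
        - \<theta> * (a + (real CARD('n) - 1) * b)"
    if "0 \<le> a" "0 \<le> b" for a b a' b'
  proof -
    have "radial_hessian e (a' + a) (b' + b) = radial_hessian e a' b' + radial_hessian e a b"
      by (simp add: radial_hessian_def algebra_simps)
    then show "- \<Theta> * (a + (real CARD('n) - 1) * b) \<le>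
        F (radial_hessian e (a' + a) (b' + b)) - F (radial_hessian e a' b')"
      "F (radial_hessian e (a' + a) (b' + b)) - F (radial_hessian e a' b') \<le>
        - \<theta> * (a + (real CARD('n) - 1) * b)"
      using assms(1) sym_radial_hessian[of e a' b'] pos_semidef_radial_hessian[OF e that]
      unfolding admissible_operator_def trace_radial_hessian[OF e, symmetric] by auto
  qed
  have H: "continuous_on UNIV H" "H 0 < 0"
    using assms(3) unfolding admissible_gradient_constraint_def by auto
  have f: "continuous_on UNIV f"
    using assms(4) by (intro convex_on_continuous) auto
  show ?thesis
  proof
    show "0 < \<theta>" "0 \<le> \<Theta>"
      using assms unfolding admissible_operator_def by auto
    show "F (radial_hessian e (a + c) b) \<le> F (radial_hessian e a b) - \<theta> * c"
      "F (radial_hessian e a b) - \<Theta> * c \<le> F (radial_hessian e (a + c) b)" if "0 \<le> c" for a b c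
      using F[of c 0 a b] that by auto
    show "F (radial_hessian e a b') \<le> F (radial_hessian e a b)"
      "F (radial_hessian e a b) - \<Theta> * (real CARD('n) - 1) * (b' - b) \<le> F (radial_hessian e a b')"
      if "b \<le> b'" for a b b'
    proof -
      \<comment> \<open>The product vanishes in dimension one, so only weak monotonicity in
        \<open>b\<close> results.\<close>
      have "0 \<le> \<theta> * ((real CARD('n) - 1) * (b' - b))"
        using that assms(2) zero_less_card_finite[where 'a = 'n] by (intro mult_nonneg_nonneg) auto
      then show "F (radial_hessian e a b') \<le> F (radial_hessian e a b)"
        "F (radial_hessian e a b) - \<Theta> * (real CARD('n) - 1) * (b' - b) \<le> F (radial_hessian e a b')"
        using F[of 0 "b' - b" a b] that by (auto simp: mult.assoc)
    qed
    show "continuous_on UNIV (\<lambda>p. H (p *\<^sub>R e))"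
      by (intro continuous_on_compose2[OF H(1)] continuous_intros) auto
    show "continuous_on UNIV (\<lambda>s. f (s *\<^sub>R e) - \<mu>)"
      by (intro continuous_intros continuous_on_compose2[OF f]) auto
  qed (use H gradient_constraint_ray[OF assms(3)] in auto)
qed

lemma eventually_nhds_norm:
  assumes "\<forall>\<^sub>F s in nhds (norm x0). P s"
  shows "\<forall>\<^sub>F x in nhds x0. P (norm x)"
proof -
  have "filterlim norm (nhds (norm x0)) (nhds x0)"
    by (intro tendsto_norm filterlim_ident)
  then show ?thesis
    using assms by (rule eventually_compose_filterlim[rotated])
qed

lemma rotationally_symmetricD: "rotationally_symmetric u \<Longrightarrow> norm x = norm y \<Longrightarrow> u x = u y"
  unfolding rotationally_symmetric_def by blast

text \<open>Since \<open>u\<close> and the quartics depend only on the norm, touching of profiles at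
  \<open>t\<close> lifts to touching at \<open>t *\<^sub>R e\<close>, where the viscosity conditions
  apply.\<close>

lemma radial_solution_of_viscosity_solution:
  fixes F :: "real^'n^'n \<Rightarrow> real" and H f :: "real^'n \<Rightarrow> real"
  assumes "admissible_operator \<theta> \<Theta> F" "\<theta> > 0" "admissible_gradient_constraint H"
    and "convex_on UNIV f" and e: "norm e = 1"
    and u: "convex_on UNIV u" "rotationally_symmetric u" "viscosity_solution F H f \<mu> u"
  shows "radial_solution \<theta> \<Theta> (\<Theta> * (real CARD('n) - 1)) (\<lambda>a b. F (radial_hessian e a b))
    (\<lambda>p. H (p *\<^sub>R e)) (\<lambda>s. f (s *\<^sub>R e) - \<mu>) (\<lambda>s. u (s *\<^sub>R e))"
proof (intro radial_solution.intro radial_equation_of_admissible radial_solution_axioms.intro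
    assms(1-5))
  let ?\<phi> = "\<lambda>s. u (s *\<^sub>R e)"
  have u_eq: "u x = ?\<phi> (norm x)" for x
    using e by (intro rotationally_symmetricD[OF u(2)]) simp
  show "convex_on UNIV ?\<phi>"
  proof (rule convex_onI)
    fix \<alpha> s t :: real
    assume "0 < \<alpha>" "\<alpha> < 1"
    then show "?\<phi> ((1 - \<alpha>) *\<^sub>R s + \<alpha> *\<^sub>R t) \<le> (1 - \<alpha>) * ?\<phi> s + \<alpha> * ?\<phi> t"
      using convex_onD[OF u(1), of \<alpha> "s *\<^sub>R e" "t *\<^sub>R e"] by (simp add: scaleR_add_left)
  qed simp
  show "?\<phi> (- s) = ?\<phi> s" for s
    by (intro rotationally_symmetricD[OF u(2)]) simp
  have sub: "max (\<mu> + F (h x0) - f x0) (H (g x0)) \<le> 0"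
    if "C2_with_derivs \<phi> g h" "local_max_at (\<lambda>x. u x - \<phi> x) x0" for \<phi> g h x0
    using u(3) that unfolding viscosity_solution_def viscosity_subsolution_def by blast
  have super: "0 \<le> max (\<mu> + F (h x0) - f x0) (H (g x0))"
    if "C2_with_derivs \<phi> g h" "local_min_at (\<lambda>x. u x - \<phi> x) x0" for \<phi> g h x0
    using u(3) that unfolding viscosity_solution_def viscosity_supersolution_def by blast
  have C2: "C2_with_derivs (\<lambda>x::real^'n. c1 * (x \<bullet> x) + c2 * (x \<bullet> x - t\<^sup>2)\<^sup>2)
     (\<lambda>x. (2 * c1 + 4 * c2 * (x \<bullet> x - t\<^sup>2)) *\<^sub>R x)
     (\<lambda>x. (2 * c1 + 4 * c2 * (x \<bullet> x - t\<^sup>2)) *\<^sub>R mat 1 + (8 * c2) *\<^sub>R outer x)" for c1 c2 t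
    by (rule C2_quartic)
  have sq: "x \<bullet> x = (norm x)\<^sup>2" for x :: "real^'n"
    by (simp add: dot_square_norm)
  have norm_te: "norm (t *\<^sub>R e) = t" if "0 \<le> t" for t
    using that e by simp
  \<comment> \<open>At \<open>t *\<^sub>R e\<close> the term
    \<open>x \<bullet> x - t\<^sup>2\<close> vanishes, leaving a radial Hessian and a gradient along
    \<open>e\<close>.\<close>
  have hess: "(2 * c1 + 4 * c2 * (t *\<^sub>R e \<bullet> t *\<^sub>R e - t\<^sup>2)) *\<^sub>R mat 1 + (8 * c2) *\<^sub>R outer (t *\<^sub>R e)
      = radial_hessian e (2 * c1 + 8 * c2 * t\<^sup>2) (2 * c1)"
    and grad: "(2 * c1 + 4 * c2 * (t *\<^sub>R e \<bullet> t *\<^sub>R e - t\<^sup>2)) *\<^sub>R (t *\<^sub>R e) = (2 * c1 * t) *\<^sub>R e"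
    if "0 \<le> t" for c1 c2 t
    using that e by (auto simp: sq outer_scaleR radial_hessian_def)
  show "F (radial_hessian e (2 * c1 + 8 * c2 * t\<^sup>2) (2 * c1)) \<le> f (t *\<^sub>R e) - \<mu> \<and>
      H ((2 * c1 * t) *\<^sub>R e) \<le> 0"
    if t: "0 < t" and ev: "\<forall>\<^sub>F s in nhds t. ?\<phi> s - (c1 * s\<^sup>2 + c2 * (s\<^sup>2 - t\<^sup>2)\<^sup>2) \<le> ?\<phi> t - c1 * t\<^sup>2"
    for t c1 c2
  proof -
    have "local_max_at (\<lambda>x. u x - (c1 * (x \<bullet> x) + c2 * (x \<bullet> x - t\<^sup>2)\<^sup>2)) (t *\<^sub>R e)"
      unfolding local_max_at_def sq
      using eventually_nhds_norm[where ?x0.0 = "t *\<^sub>R e", unfolded norm_te[OF less_imp_le[OF t]], OF ev]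
      by (rule eventually_mono) (use t e in \<open>simp add: u_eq[symmetric]\<close>)
    from sub[OF C2 this] show ?thesis
      unfolding hess[OF less_imp_le[OF t]] grad[OF less_imp_le[OF t]] by simp
  qed
  show "f (t *\<^sub>R e) - \<mu> \<le> F (radial_hessian e (2 * c1 + 8 * c2 * t\<^sup>2) (2 * c1)) \<or>
      0 \<le> H ((2 * c1 * t) *\<^sub>R e)"
    if t: "0 \<le> t" and ev: "\<forall>\<^sub>F s in nhds t. ?\<phi> t - c1 * t\<^sup>2 \<le> ?\<phi> s - (c1 * s\<^sup>2 + c2 * (s\<^sup>2 - t\<^sup>2)\<^sup>2)"
    for t c1 c2
  proof -
    have "local_min_at (\<lambda>x. u x - (c1 * (x \<bullet> x) + c2 * (x \<bullet> x - t\<^sup>2)\<^sup>2)) (t *\<^sub>R e)"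
      unfolding local_min_at_def sq
      using eventually_nhds_norm[where ?x0.0 = "t *\<^sub>R e", unfolded norm_te[OF t], OF ev]
      by (rule eventually_mono) (use t e in \<open>simp add: u_eq[symmetric]\<close>)
    from super[OF C2 this] show ?thesis
      unfolding hess[OF t] grad[OF t] by (auto simp: le_max_iff_disj)
  qed
qed

theorem proposition5p2:
  fixes F :: "real^'n^'n \<Rightarrow> real" and H f :: "real^'n \<Rightarrow> real"
    and \<theta> \<Theta> :: real and u1 u2 :: "real^'n \<Rightarrow> real"
  assumes "admissible_operator \<theta> \<Theta> F" and "\<theta> > 0"
    and "admissible_gradient_constraint H"
    and "convex_on UNIV f" and "superlinear f"
    and "\<And>Q x. orthogonal_matrix Q \<Longrightarrow> f (Q *v x) = f x"
    and "\<And>Q p. orthogonal_matrix Q \<Longrightarrow> H (transpose Q *v p) = H p"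
    and "\<And>Q M. orthogonal_matrix Q \<Longrightarrow> sym_matrix M \<Longrightarrow> F (Q ** M ** transpose Q) = F M"
    and "convex_on UNIV u1" and "rotationally_symmetric u1"
    and "viscosity_solution F H f (eigenvalue F H f) u1" and "asymptotic_to_support H u1"
    and "convex_on UNIV u2" and "rotationally_symmetric u2"
    and "viscosity_solution F H f (eigenvalue F H f) u2" and "asymptotic_to_support H u2"
  shows "\<exists>c. \<forall>x. u1 x = u2 x + c"
proof -
  obtain e :: "real^'n" where e: "norm e = 1"
    using vector_choose_size[of 1] by auto
  \<comment> \<open>Using the same unit vector and the same eigenvalue for both solutions gives
    their profiles one common scalar equation.\<close>
  note radial = radial_solution_of_viscosity_solution[OF assms(1-4) e]
  have "u1 x = u2 x + (u1 0 - u2 0)" for x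
  proof -
    have "u1 (norm x *\<^sub>R e) - u2 (norm x *\<^sub>R e) = u1 (0 *\<^sub>R e) - u2 (0 *\<^sub>R e)"
      using radial_solution_unique[OF radial[OF assms(9-11)] radial[OF assms(13-15)]] by simp
    moreover have "u1 (norm x *\<^sub>R e) = u1 x" "u2 (norm x *\<^sub>R e) = u2 x"
      using e by (auto intro!: rotationally_symmetricD[OF assms(10)] rotationally_symmetricD[OF assms(14)])
    ultimately show ?thesis
      by simp
  qed
  then show ?thesis
    by blast
qed

end
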